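(* Let $S$ be an ordered semigroup that satisfies axioms O1–O5 and let $s,t\in S$. Then $\hat s\leq \hat t$ (that is, $\lambda(s)\leq\lambda(t)$ for every functional $\lambda$ on $S$) if and only if for every $\epsilon>0$ and every $s'\in S$ with $s'\ll s$ there exist $M,N\in \mathbb{N}$ such that $\frac{M}{N}>1-\epsilon$ and $Ms'\leq Nt$.
   Context: An ordered semigroup is an abelian monoid with a translation invariant order relation in which $0$ is the smallest element. For $s,t$ in an ordered set, $s\ll t$ means: for every increasing sequence $(t_n)$ (having a supremum) with $t\leq \sup_n t_n$ there is $n_0$ with $s\leq t_{n_0}$. Axioms on an ordered semigroup $S$: O1: every increasing sequence has a supremum. O2: every $s\in S$ is the supremum of a sequence $(s_n)$ with $s_n\ll s_{n+1}$ for all $n$. O3: if $s_i\ll t_i$ for $i=1,2$ then $s_1+s_2\ll t_1+t_2$. O4: if $(s_n),(t_n)$ are increasing then $\sup_n(s_n+t_n)=\sup_n s_n+\sup_n t_n$. O5: if $s'\ll s\leq t$ then there exists $r$ with $s'+r\leq t\leq s+r$. A functional on $S$ is a map $\lambda\colon S\to[0,\infty]$ that is additive, order preserving, sends $0$ to $0$, and preserves suprema of increasing sequences. $\mathrm{F}(S)$ is the set of all functionals on $S$. For $s\in S$, $\hat s\colon \mathrm{F}(S)\to[0,\infty]$ is $\hat s(\lambda)=\lambda(s)$; such functions are ordered pointwise. *)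

theory Defs
  imports "HOL-Library.Extended_Nonnegative_Real"
begin

context order
begin

text \<open>The order is not assumed complete, so suprema of sequences are expressed
  relationally: \<open>seq_sup x u\<close> says that \<open>u\<close> is the least upper bound of \<open>x\<close>.
  Outside this class context \<open>inc_seq\<close> coincides with \<open>incseq\<close>.\<close>

abbreviation inc_seq :: "(nat \<Rightarrow> 'a) \<Rightarrow> bool" where
  "inc_seq x \<equiv> monotone (\<le>) (\<le>) x"

definition seq_sup :: "(nat \<Rightarrow> 'a) \<Rightarrow> 'a \<Rightarrow> bool" where
  "seq_sup x u \<longleftrightarrow> (\<forall>n. x n \<le> u) \<and> (\<forall>v. (\<forall>n. x n \<le> v) \<longrightarrow> u \<le> v)"

definition way_below :: "'a \<Rightarrow> 'a \<Rightarrow> bool"  (infix "\<lless>" 50) where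
  "s \<lless> t \<longleftrightarrow>
    (\<forall>x u. inc_seq x \<longrightarrow> seq_sup x u \<longrightarrow> t \<le> u \<longrightarrow> (\<exists>n. s \<le> x n))"

end

class ordered_semigroup = ordered_comm_monoid_add +
  assumes zero_least: "0 \<le> s"

class cuntz_semigroup = ordered_semigroup +
  assumes O1: "inc_seq x \<Longrightarrow> \<exists>u. seq_sup x u"
    and O2: "\<exists>x. (\<forall>n. x n \<lless> x (Suc n)) \<and> seq_sup x s"
    and O3: "s1 \<lless> t1 \<Longrightarrow> s2 \<lless> t2 \<Longrightarrow> s1 + s2 \<lless> t1 + t2"
    and O4: "inc_seq x \<Longrightarrow> inc_seq y \<Longrightarrow> seq_sup x u \<Longrightarrow> seq_sup y v
      \<Longrightarrow> seq_sup (\<lambda>n. x n + y n) (u + v)"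
    and O5: "s' \<lless> s \<Longrightarrow> s \<le> t \<Longrightarrow> \<exists>r. s' + r \<le> t \<and> t \<le> s + r"

definition functionals :: "('a::ordered_semigroup \<Rightarrow> ennreal) set" where
  "functionals = {l.
     (\<forall>s t. l (s + t) = l s + l t) \<and>
     mono l \<and>
     l 0 = 0 \<and>
     (\<forall>x u. incseq x \<longrightarrow> seq_sup x u \<longrightarrow> l u = (SUP n. l (x n)))}"

definition hat :: "'a \<Rightarrow> ('a::ordered_semigroup \<Rightarrow> ennreal) \<Rightarrow> ennreal" where
  "hat s l = l s"

definition nat_mult :: "nat \<Rightarrow> 'a::comm_monoid_add \<Rightarrow> 'a" where
  "nat_mult n s = (\<Sum>i<n. s)"

end

(* The regularization SUP {l x | x << s} of an additive monotone map l is a functional, so the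
   hypothesis on functionals yields l s' <= l t for every additive monotone l and every s' << s.
   The gauge "ratio t z" = inf {N/M | M z <= N t} is sublinear, and a Hahn-Banach argument provides an
   additive monotone l below it that agrees with it at s'.  Hence the gauge of s' is at most
   l t <= 1, which is the claim.  Infinite values of l are allowed throughout, so the case in
   which no multiple of t dominates s' needs no separate treatment. *)
theory Submission
  imports Defs
begin

section \<open>Multiples in a commutative monoid\<close>

lemma nat_mult_0 [simp]: "nat_mult 0 a = 0"
  and nat_mult_Suc: "nat_mult (Suc n) a = a + nat_mult n a"
  by (simp_all add: nat_mult_def add.commute)

lemma nat_mult_1 [simp]: "nat_mult (Suc 0) a = a"
  by (simp add: nat_mult_Suc)

lemma nat_mult_add_left: "nat_mult (m + n) a = nat_mult m a + nat_mult n a"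
  by (induction m) (simp_all add: nat_mult_Suc add.assoc)

lemma nat_mult_add_right: "nat_mult n (a + b) = nat_mult n a + nat_mult n b"
  by (simp add: nat_mult_def sum.distrib)

lemma nat_mult_mult: "nat_mult (m * n) a = nat_mult m (nat_mult n a)"
  by (induction m) (simp_all add: nat_mult_Suc nat_mult_add_left)

lemma nat_mult_mono:
  fixes a b :: "'a::ordered_comm_monoid_add"
  shows "a \<le> b \<Longrightarrow> nat_mult n a \<le> nat_mult n b"
  by (simp add: nat_mult_def sum_mono)

lemma additive_nat_mult:
  fixes l :: "'a::comm_monoid_add \<Rightarrow> ennreal"
  assumes "\<And>a b. l (a + b) = l a + l b" "l 0 = 0"
  shows "l (nat_mult n a) = of_nat n * l a"
  by (induction n) (simp_all add: assms nat_mult_Suc distrib_right)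

section \<open>Sublinear maps and their shifts\<close>

definition sublinear :: "('a::ordered_semigroup \<Rightarrow> ennreal) \<Rightarrow> bool" where
  "sublinear p \<longleftrightarrow> mono p \<and> p 0 = 0 \<and> (\<forall>a b. p (a + b) \<le> p a + p b) \<and>
     (\<forall>n a. p (nat_mult n a) = of_nat n * p a)"

text \<open>Subadditivity and \<open>p 0 = 0\<close> already give
  \<open>p (nat_mult n a) \<le> of_nat n * p a\<close> by induction, so only the reverse inequality
  is left to check, and only for positive \<open>n\<close>.\<close>

lemma sublinearI:
  assumes "\<And>a b. a \<le> b \<Longrightarrow> p a \<le> p b" "p 0 = 0" "\<And>a b. p (a + b) \<le> p a + p b"
    "\<And>n a. n > 0 \<Longrightarrow> of_nat n * p a \<le> p (nat_mult n a)"
  shows "sublinear p"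
proof -
  have "p (nat_mult n a) \<le> of_nat n * p a" for n a
  proof (induction n)
    case (Suc n)
    then show ?case
      using assms(3)[of a "nat_mult n a"]
      by (auto simp: nat_mult_Suc distrib_right intro: order_trans add_left_mono)
  qed (simp add: assms)
  moreover have "of_nat n * p a \<le> p (nat_mult n a)" for n a
    using assms(4) by (cases "n = 0") auto
  ultimately show ?thesis
    using assms by (auto simp: sublinear_def intro!: monoI antisym)
qed

lemma sublinearD:
  assumes "sublinear p"
  shows "a \<le> b \<Longrightarrow> p a \<le> p b" "p 0 = 0" "p (a + b) \<le> p a + p b"
    "p (nat_mult n a) = of_nat n * p a"
  using assms by (auto simp: sublinear_def mono_def)

text \<open>The analogue of the Hahn--Banach step \<open>inf r. p (z + r a) - r p a\<close> in a vector space.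
  The truncated subtraction of \<^typ>\<open>ennreal\<close> loses nothing when \<open>p\<close> is sublinear, since then
  \<open>n p a \<le> p (z + n a)\<close>.\<close>

definition shift :: "('a::ordered_semigroup \<Rightarrow> ennreal) \<Rightarrow> 'a \<Rightarrow> 'a \<Rightarrow> ennreal" where
  "shift p a z = (INF n. p (z + nat_mult n a) - of_nat n * p a)"

text \<open>Truncation only helps on the right: \<open>a \<le> (a - b) + b\<close> holds whichever
  of \<open>a\<close> and \<open>b\<close> is larger, and likewise for \<open>c\<close> and
  \<open>d\<close>.\<close>

lemma ennreal_add_diff_add_le:
  fixes a b c d :: ennreal
  shows "(a + c) - (b + d) \<le> (a - b) + (c - d)"
proof -
  have "a \<le> (a - b) + b" "c \<le> (c - d) + d"
    using linear[of a b] linear[of c d] by (auto simp: diff_add_self_ennreal)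
  then have "a + c \<le> ((a - b) + b) + ((c - d) + d)"
    by (rule add_mono)
  then show ?thesis
    by (simp add: ennreal_minus_le_iff ac_simps)
qed

context
  fixes p :: "'a::ordered_semigroup \<Rightarrow> ennreal" and a :: 'a
  assumes p: "sublinear p" and fin: "p a \<noteq> top"
begin

text \<open>By subadditivity one more copy of \<open>a\<close> raises \<open>p\<close> by at most
  \<open>p a\<close>, which is exactly the additional amount subtracted. Finiteness of
  \<open>p a\<close> permits the cancellation.\<close>

lemma decseq_shift_seq: "decseq (\<lambda>n. p (z + nat_mult n a) - of_nat n * p a)"
proof (rule decseq_SucI)
  fix n
  have "p (z + nat_mult (Suc n) a) - of_nat (Suc n) * p a
      \<le> (p a + p (z + nat_mult n a)) - (p a + of_nat n * p a)"
    using sublinearD(3)[OF p, of a "z + nat_mult n a"]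
    by (intro ennreal_minus_mono) (simp_all add: nat_mult_Suc add_ac distrib_right)
  also have "\<dots> = p (z + nat_mult n a) - of_nat n * p a"
    using fin by (simp add: diff_add_eq_diff_diff_swap_ennreal)
  finally show "p (z + nat_mult (Suc n) a) - of_nat (Suc n) * p a
      \<le> p (z + nat_mult n a) - of_nat n * p a" .
qed

text \<open>Reading the infimum as a limit lets identities and inequalities between terms pass to
  sums of shifts.\<close>

lemma shift_tendsto: "(\<lambda>n. p (z + nat_mult n a) - of_nat n * p a) \<longlonglongrightarrow> shift p a z"
  unfolding shift_def by (rule LIMSEQ_INF[OF decseq_shift_seq])

lemma shift_le: "shift p a z \<le> p z"
  unfolding shift_def by (rule INF_lower2[of 0]) simp_all

lemma sublinear_shift: "sublinear (shift p a)"
proof (rule sublinearI)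
  show "shift p a y \<le> shift p a z" if "y \<le> z" for y z
    unfolding shift_def
    by (intro INF_mono' ennreal_minus_mono sublinearD(1)[OF p] add_right_mono that order_refl)
  show "shift p a 0 = 0"
    using shift_le[of 0] by (simp add: sublinearD(2)[OF p])
  show "shift p a (y + z) \<le> shift p a y + shift p a z" for y z
  proof (rule LIMSEQ_le)
    show "(\<lambda>n. (p (y + nat_mult n a) - of_nat n * p a) + (p (z + nat_mult n a) - of_nat n * p a))
      \<longlonglongrightarrow> shift p a y + shift p a z"
      by (intro tendsto_add shift_tendsto)
    have "shift p a (y + z) \<le> (p (y + nat_mult n a) - of_nat n * p a) + (p (z + nat_mult n a) - of_nat n * p a)" for n
    proof -
      \<comment> \<open>The even index \<open>n + n\<close> gives \<open>n\<close> copies of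
        \<open>a\<close> to each of \<open>y\<close> and \<open>z\<close>.\<close>
      have "shift p a (y + z) \<le> p (y + z + nat_mult (n + n) a) - of_nat (n + n) * p a"
        unfolding shift_def by (rule INF_lower) simp
      also have "\<dots> \<le> (p (y + nat_mult n a) + p (z + nat_mult n a)) - (of_nat n * p a + of_nat n * p a)"
        using sublinearD(3)[OF p, of "y + nat_mult n a" "z + nat_mult n a"]
        by (intro ennreal_minus_mono) (simp_all add: nat_mult_add_left ac_simps distrib_left)
      also have "\<dots> \<le> (p (y + nat_mult n a) - of_nat n * p a) + (p (z + nat_mult n a) - of_nat n * p a)"
        by (rule ennreal_add_diff_add_le)
      finally show ?thesis .
    qed
    then show "\<exists>N. \<forall>n\<ge>N. shift p a (y + z) \<le>
      (p (y + nat_mult n a) - of_nat n * p a) + (p (z + nat_mult n a) - of_nat n * p a)"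
      by blast
  qed (rule tendsto_const)
  show "of_nat k * shift p a z \<le> shift p a (nat_mult k z)" if "k > 0" for k z
    unfolding shift_def[of p a "nat_mult k z"]
  proof (rule INF_greatest)
    fix n
    have "of_nat k * shift p a z \<le> of_nat k * (p (z + nat_mult n a) - of_nat n * p a)"
      unfolding shift_def by (intro mult_left_mono INF_lower) simp_all
    also have "\<dots> = of_nat k * p (z + nat_mult n a) - of_nat k * (of_nat n * p a)"
      by (rule ennreal_right_diff_distrib) simp
    also have "\<dots> = p (nat_mult k z + nat_mult (k * n) a) - of_nat (k * n) * p a"
      using sublinearD(4)[OF p, of k "z + nat_mult n a"]
      by (simp add: nat_mult_add_right nat_mult_mult mult.assoc)
    \<comment> \<open>The terms decrease and \<open>n \<le> k * n\<close> because
      \<open>k > 0\<close>.\<close>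
    also have "\<dots> \<le> p (nat_mult k z + nat_mult n a) - of_nat n * p a"
      using decseqD[OF decseq_shift_seq, of n "k * n" "nat_mult k z"] that by simp
    finally show "of_nat k * shift p a z \<le> p (nat_mult k z + nat_mult n a) - of_nat n * p a" .
  qed
qed

text \<open>Replacing \<open>z\<close> by \<open>z + a\<close> moves the sequence one index ahead
  and adds \<open>p a\<close> to each term; the limit does not see the index.\<close>

lemma shift_add_self: "shift p a (z + a) = shift p a z + p a"
proof (rule LIMSEQ_unique[OF shift_tendsto])
  have *: "p (z + a + nat_mult n a) - of_nat n * p a
      = (p (z + nat_mult (Suc n) a) - of_nat (Suc n) * p a) + p a" for n
  proof -
    \<comment> \<open>Nothing is truncated: \<open>0\<close> is least and \<open>p\<close> is
      homogeneous.\<close>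
    have "of_nat (Suc n) * p a \<le> p (z + nat_mult (Suc n) a)"
      using sublinearD(1)[OF p, of "nat_mult (Suc n) a" "z + nat_mult (Suc n) a"] zero_least[of z]
      by (simp add: sublinearD(4)[OF p] add_increasing)
    moreover have "of_nat n * p a \<noteq> top"
      using fin by (simp add: ennreal_mult_eq_top_iff)
    moreover have "p (z + nat_mult (Suc n) a) = p (z + a + nat_mult n a)"
      by (simp add: nat_mult_Suc ac_simps)
    ultimately show ?thesis
      using fin
      by (cases "p (z + a + nat_mult n a)"; cases "p a")
        (auto simp: distrib_right ennreal_of_nat_eq_real_of_nat ennreal_mult'[symmetric]
          ennreal_plus[symmetric] ennreal_minus algebra_simps simp del: ennreal_plus)
  qed
  show "(\<lambda>n. p (z + a + nat_mult n a) - of_nat n * p a) \<longlonglongrightarrow> shift p a z + p a"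
    unfolding * by (intro tendsto_add LIMSEQ_Suc[OF shift_tendsto] tendsto_const)
qed

text \<open>The differences are not truncated, so \<open>c\<close> can be pulled out of every term.
  This is what keeps the value at a prescribed element unchanged under shifts in other
  directions.\<close>

lemma shift_add_fixed:
  assumes x: "\<And>z. p (z + x) = p z + c"
  shows "shift p a (z + x) = shift p a z + c"
proof (rule LIMSEQ_unique[OF shift_tendsto])
  have *: "p (z + x + nat_mult n a) - of_nat n * p a
      = (p (z + nat_mult n a) - of_nat n * p a) + c" for n
  proof -
    have "of_nat n * p a \<le> p (z + nat_mult n a)"
      using sublinearD(1)[OF p, of "nat_mult n a" "z + nat_mult n a"] zero_least[of z]
      by (simp add: sublinearD(4)[OF p] add_increasing)
    moreover have "p (z + x + nat_mult n a) = p (z + nat_mult n a) + c"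
      using x[of "z + nat_mult n a"] by (simp add: ac_simps)
    ultimately show ?thesis
      by (metis ennreal_diff_add_assoc add.commute)
  qed
  show "(\<lambda>n. p (z + x + nat_mult n a) - of_nat n * p a) \<longlonglongrightarrow> shift p a z + c"
    unfolding * by (intro tendsto_add shift_tendsto tendsto_const)
qed

end

section \<open>A Hahn-Banach theorem by Zorn's lemma\<close>

lemma le_add_INF_ennreal:
  fixes b c :: ennreal
  assumes "\<And>i. i \<in> I \<Longrightarrow> b \<le> c + f i"
  shows "b \<le> c + (INF i\<in>I. f i)"
proof (cases "c = top")
  case False
  then have "b - c \<le> (INF i\<in>I. f i)"
    using assms by (intro INF_greatest) (simp add: ennreal_minus_le_iff)
  then show ?thesis
    using False by (simp add: ennreal_minus_le_iff)
qed simp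

text \<open>Subadditivity is where the chain matters: the smaller of \<open>p\<close> and
  \<open>q\<close> bounds the value at \<open>y + z\<close> by \<open>p y + q z\<close>, and the two
  infima are then taken one after the other.\<close>

lemma sublinear_INF_chain:
  fixes C :: "('a::ordered_semigroup \<Rightarrow> ennreal) set"
  assumes ne: "C \<noteq> {}" and sub: "\<And>p. p \<in> C \<Longrightarrow> sublinear p"
    and chain: "\<And>p q. p \<in> C \<Longrightarrow> q \<in> C \<Longrightarrow> p \<le> q \<or> q \<le> p"
  shows "sublinear (\<lambda>z. INF p\<in>C. p z)"
proof (rule sublinearI)
  show "(INF p\<in>C. p y) \<le> (INF p\<in>C. p z)" if "y \<le> z" for y z
    using sublinearD(1)[OF sub that] by (intro INF_mono) auto
  show "(INF p\<in>C. p 0) = 0"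
    using ne by (simp add: sublinearD(2)[OF sub])
  show "(INF p\<in>C. p (y + z)) \<le> (INF p\<in>C. p y) + (INF p\<in>C. p z)" for y z
  proof -
    have "(INF p\<in>C. p (y + z)) \<le> p y + q z" if pq: "p \<in> C" "q \<in> C" for p q
    proof -
      obtain r where r: "r \<in> C" "r \<le> p" "r \<le> q"
        using chain[OF pq] pq by blast
      have "(INF p\<in>C. p (y + z)) \<le> r (y + z)"
        by (rule INF_lower[OF r(1)])
      also have "\<dots> \<le> r y + r z"
        by (rule sublinearD(3)[OF sub[OF r(1)]])
      also have "\<dots> \<le> p y + q z"
        using r by (intro add_mono) (auto simp: le_fun_def)
      finally show ?thesis .
    qed
    then have "(INF p\<in>C. p (y + z)) \<le> p y + (INF q\<in>C. q z)" if "p \<in> C" for p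
      using that by (intro le_add_INF_ennreal)
    then have "(INF p\<in>C. p (y + z)) \<le> (INF q\<in>C. q z) + (INF p\<in>C. p y)"
      by (intro le_add_INF_ennreal) (simp add: add.commute)
    then show ?thesis
      by (simp add: add.commute)
  qed
  show "of_nat n * (INF p\<in>C. p z) \<le> (INF p\<in>C. p (nat_mult n z))" for n z
    by (intro INF_greatest) (auto simp: sublinearD(4)[OF sub] intro: mult_left_mono INF_lower)
qed

text \<open>A minimal sublinear \<open>l\<close> coincides with all its shifts and is therefore additive. Requiring
  \<open>l (z + x) = l z + p x\<close>, which shifts preserve, keeps the value at \<open>x\<close> from dropping.\<close>

theorem exists_additive_below_sublinear:
  fixes p :: "'a::ordered_semigroup \<Rightarrow> ennreal"
  assumes p: "sublinear p"
  obtains l where "\<And>y z. l (y + z) = l y + l z" "mono l" "l 0 = 0" "l \<le> p" "l x = p x"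
proof -
  define A where "A = {q. sublinear q \<and> q \<le> p \<and> (\<forall>z. q (z + x) = q z + p x)}"
  \<comment> \<open>If \<open>p x\<close> is infinite, monotonicity makes both sides of the
    condition infinite for \<open>p\<close> itself; otherwise shifting by \<open>x\<close> enforces
    it.\<close>
  have "\<exists>q. q \<in> A"
  proof (cases "p x = top")
    case True
    have "p (z + x) = top" for z
      using sublinearD(1)[OF p, of x "z + x"] zero_least[of z] True by (simp add: add_increasing top_unique)
    then have "p \<in> A"
      using p True by (simp add: A_def)
    then show ?thesis by blast
  next
    case False
    then have "shift p x \<in> A"
      using sublinear_shift[OF p] shift_le[OF p] shift_add_self[OF p] by (simp add: A_def le_fun_def)
    then show ?thesis by blast
  qed
  then obtain q0 where q0: "q0 \<in> A" ..
  \<comment> \<open>Zorn's lemma is applied to the reversed order, so that its maximal element is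
    minimal for \<open>\<le>\<close>.\<close>
  have "\<exists>m\<in>A. \<forall>q\<in>A. q \<le> m \<longrightarrow> q = m"
  proof (rule predicate_Zorn)
    show "partial_order_on A (relation_of (\<lambda>q r. r \<le> q) A)"
      by (rule partial_order_on_relation_ofI) auto
    fix C assume C: "C \<in> Chains (relation_of (\<lambda>q r. r \<le> q) A)"
    have CA: "C \<subseteq> A"
      using C by (auto simp: Chains_def relation_of_def)
    have chain: "\<And>q r. q \<in> C \<Longrightarrow> r \<in> C \<Longrightarrow> q \<le> r \<or> r \<le> q"
      using C by (auto simp: Chains_def relation_of_def)
    show "\<exists>u\<in>A. \<forall>q\<in>C. u \<le> q"
    \<comment> \<open>The infimum over an empty chain would be \<open>top\<close> everywhere, which
      is not in \<open>A\<close>; there \<open>q0\<close> serves as the bound.\<close>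
    proof (cases "C = {}")
      case True
      then show ?thesis using q0 by auto
    next
      case False
      let ?u = "\<lambda>z. INF q\<in>C. q z"
      have "sublinear ?u"
        using CA chain False by (intro sublinear_INF_chain) (auto simp: A_def)
      moreover have "?u \<le> p"
      proof (rule le_funI)
        fix z
        obtain q where "q \<in> C" using False by blast
        moreover from this have "q z \<le> p z"
          using CA by (auto simp: A_def le_fun_def)
        ultimately show "?u z \<le> p z"
          by (intro INF_lower2)
      qed
      moreover have "?u (z + x) = ?u z + p x" for z
      proof -
        have "?u (z + x) = (INF q\<in>C. p x + q z)"
          using CA by (intro INF_cong) (auto simp: A_def add.commute[of "p x"])
        also have "\<dots> = p x + ?u z"
          by (intro antisym le_add_INF_ennreal INF_greatest add_left_mono INF_lower)
        finally show ?thesis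
          by (simp add: add.commute)
      qed
      ultimately have "?u \<in> A"
        by (simp add: A_def)
      then show ?thesis
        by (intro bexI[of _ ?u]) (auto simp: le_fun_def intro: INF_lower)
    qed
  qed
  then obtain l where l: "l \<in> A" and min: "\<And>q. q \<in> A \<Longrightarrow> q \<le> l \<Longrightarrow> q = l"
    by blast
  have sub: "sublinear l" and le: "l \<le> p" and lx: "\<And>z. l (z + x) = l z + p x"
    using l by (auto simp: A_def)
  have "l (y + z) = l y + l z" for y z
  \<comment> \<open>Shifts need a finite value at \<open>z\<close>; at an infinite one monotonicity
    makes both sides \<open>top\<close>.\<close>
  proof (cases "l z = top")
    case True
    then show ?thesis
      using sublinearD(1)[OF sub, of z "y + z"] zero_least[of y] by (simp add: add_increasing top_unique)
  next
    case False
    have "shift l z \<in> A"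
      using sublinear_shift[OF sub False] shift_le[OF sub False] shift_add_fixed[OF sub False lx] le
      by (auto simp: A_def le_fun_def intro: order_trans)
    \<comment> \<open>By minimality, so \<open>shift_add_self\<close> becomes additivity of
      \<open>l\<close>.\<close>
    then have "shift l z = l"
      using shift_le[OF sub False] by (intro min) (auto simp: le_fun_def)
    then show ?thesis
      using shift_add_self[OF sub False] by simp
  qed
  moreover have "l x = p x"
    using lx[of 0] sublinearD(2)[OF sub] by simp
  ultimately show ?thesis
    using that[of l] sub le by (auto simp: sublinear_def)
qed

section \<open>The gauge of an element\<close>

definition ratio :: "'a::ordered_semigroup \<Rightarrow> 'a \<Rightarrow> ennreal" where
  "ratio t z = (INF (M, N) \<in> {(M, N). M > 0 \<and> nat_mult M z \<le> nat_mult N t}. ennreal (real N / real M))"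

lemma ratio_le:
  "M > 0 \<Longrightarrow> nat_mult M z \<le> nat_mult N t \<Longrightarrow> ratio t z \<le> ennreal (real N / real M)"
  unfolding ratio_def by (rule INF_lower2[of "(M, N)"]) auto

lemma le_ratioI:
  assumes "\<And>M N. M > 0 \<Longrightarrow> nat_mult M z \<le> nat_mult N t \<Longrightarrow> b \<le> ennreal (real N / real M)"
  shows "b \<le> ratio t z"
  unfolding ratio_def using assms by (intro INF_greatest) auto

lemma sublinear_ratio:
  fixes t :: "'a::ordered_semigroup"
  shows "sublinear (ratio t)"
proof (rule sublinearI)
  show "ratio t y \<le> ratio t z" if "y \<le> z" for y z
    using that by (intro le_ratioI ratio_le) (auto intro: order_trans nat_mult_mono)
  show "ratio t 0 = 0"
    using ratio_le[of 1 0 0 t] by simp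
  show "ratio t (y + z) \<le> ratio t y + ratio t z" for y z
  proof -
    have *: "ratio t (y + z) \<le> ennreal (real N / real M) + ennreal (real N' / real M')"
      if "M > 0" "nat_mult M y \<le> nat_mult N t" "M' > 0" "nat_mult M' z \<le> nat_mult N' t" for M N M' N'
    proof -
      \<comment> \<open>Both fractions are brought to the common denominator
        \<open>M * M'\<close>.\<close>
      have "nat_mult (M' * M) y + nat_mult (M * M') z \<le> nat_mult (M' * N) t + nat_mult (M * N') t"
        unfolding nat_mult_mult by (intro add_mono nat_mult_mono that)
      then have "ratio t (y + z) \<le> ennreal (real (M' * N + M * N') / real (M * M'))"
        using that by (intro ratio_le)
          (simp_all add: nat_mult_add_left nat_mult_add_right mult.commute)
      also have "real (M' * N + M * N') / real (M * M') = real N / real M + real N' / real M'"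
        using that by (simp add: field_simps)
      finally show ?thesis by simp
    qed
    have "ratio t (y + z) \<le> ennreal (real N / real M) + ratio t z"
      if "M > 0" "nat_mult M y \<le> nat_mult N t" for M N
      unfolding ratio_def[of t z] using *[OF that] by (intro le_add_INF_ennreal) auto
    then have "ratio t (y + z) \<le> ratio t z + ratio t y"
      unfolding ratio_def[of t y] by (intro le_add_INF_ennreal) (auto simp: add.commute)
    then show ?thesis
      by (simp add: add.commute)
  qed
  show "of_nat n * ratio t z \<le> ratio t (nat_mult n z)" if "n > 0" for n z
  proof (rule le_ratioI)
    fix M N :: nat assume "M > 0" "nat_mult M (nat_mult n z) \<le> nat_mult N t"
    then have "ratio t z \<le> ennreal (real N / real (M * n))"
      using that by (intro ratio_le) (auto simp: nat_mult_mult)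
    then have "of_nat n * ratio t z \<le> of_nat n * ennreal (real N / real (M * n))"
      by (rule mult_left_mono) simp
    also have "\<dots> = ennreal (real N / real M)"
      using that by (simp add: ennreal_of_nat_eq_real_of_nat ennreal_mult'[symmetric])
    finally show "of_nat n * ratio t z \<le> ennreal (real N / real M)" .
  qed
qed

section \<open>The way-below relation and regularization\<close>

lemma way_below_imp_le: "s \<lless> t \<Longrightarrow> s \<le> t"
  unfolding way_below_def by (erule allE[of _ "\<lambda>_. t"], erule allE[of _ t])
    (auto simp: seq_sup_def monotone_def)

lemma le_way_below_trans: "s \<le> t \<Longrightarrow> t \<lless> u \<Longrightarrow> s \<lless> u"
  unfolding way_below_def by (meson order_trans)

lemma way_below_le_trans: "s \<lless> t \<Longrightarrow> t \<le> u \<Longrightarrow> s \<lless> u"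
  unfolding way_below_def by (meson order_trans)

lemma way_below_seqE:
  fixes s :: "'a::cuntz_semigroup"
  obtains x where "incseq x" "seq_sup x s" "\<And>n. x n \<lless> x (Suc n)" "\<And>n. x n \<lless> s"
proof -
  obtain x where x: "\<And>n. x n \<lless> x (Suc n)" "seq_sup x s"
    using O2 by blast
  then have "x n \<lless> s" for n
    by (meson seq_sup_def way_below_le_trans)
  moreover have "incseq x"
    using x(1) by (intro incseq_SucI way_below_imp_le)
  ultimately show ?thesis
    using that x by blast
qed

text \<open>Keeps the set in \<open>regularization\<close> nonempty, so that a summand can be moved
  through its supremum.\<close>

lemma zero_way_below: "0 \<lless> (s::'a::ordered_semigroup)"
  by (simp add: way_below_def zero_least)

definition regularization :: "('a::ordered_semigroup \<Rightarrow> ennreal) \<Rightarrow> 'a \<Rightarrow> ennreal" where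
  "regularization l s = (SUP x \<in> {x. x \<lless> s}. l x)"

lemma le_regularization: "x \<lless> s \<Longrightarrow> l x \<le> regularization l s"
  unfolding regularization_def by (rule SUP_upper) simp

lemma regularization_leI: "(\<And>x. x \<lless> s \<Longrightarrow> l x \<le> b) \<Longrightarrow> regularization l s \<le> b"
  unfolding regularization_def by (rule SUP_least) simp

lemma regularization_le: "mono l \<Longrightarrow> regularization l s \<le> l s"
  by (rule regularization_leI) (auto dest: way_below_imp_le monoD)

lemma regularization_functional:
  fixes l :: "'a::cuntz_semigroup \<Rightarrow> ennreal"
  assumes add: "\<And>a b. l (a + b) = l a + l b" and mono: "mono l" and zero: "l 0 = 0"
  shows "regularization l \<in> functionals"
proof -
  have regmono: "mono (regularization l)"
    by (intro monoI regularization_leI le_regularization) (rule way_below_le_trans)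
  have "regularization l (s + t) = regularization l s + regularization l t" for s t
  proof (rule antisym)
    obtain x where x: "incseq x" "seq_sup x s" "\<And>n. x n \<lless> s"
      using way_below_seqE by metis
    obtain y where y: "incseq y" "seq_sup y t" "\<And>n. y n \<lless> t"
      using way_below_seqE by metis
    \<comment> \<open>By \<open>O4\<close>, anything way below \<open>s + t\<close> lies below some
      \<open>x n + y n\<close>, which gives subadditivity.\<close>
    have sup: "seq_sup (\<lambda>n. x n + y n) (s + t)" 
      using x y by (intro O4)
    have inc: "incseq (\<lambda>n. x n + y n)"
      using x(1) y(1) by (auto simp: incseq_def intro: add_mono)
    show "regularization l (s + t) \<le> regularization l s + regularization l t"
    proof (rule regularization_leI)
      fix z assume "z \<lless> s + t"
      then obtain n where "z \<le> x n + y n"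
        using sup inc unfolding way_below_def by blast
      then have "l z \<le> l (x n) + l (y n)"
        using monoD[OF mono] by (metis add)
      also have "\<dots> \<le> regularization l s + regularization l t"
        by (intro add_mono le_regularization x y)
      finally show "l z \<le> regularization l s + regularization l t" .
    qed
    \<comment> \<open>Superadditivity comes from \<open>O3\<close>; the suprema over
      \<open>a\<close> and \<open>b\<close> are taken in turn.\<close>
    have "l a + l b \<le> regularization l (s + t)" if "a \<lless> s" "b \<lless> t" for a b
      using le_regularization[OF O3[OF that], of l] by (simp add: add)
    then have "l a + (SUP b\<in>{b. b \<lless> t}. l b) \<le> regularization l (s + t)" if "a \<lless> s" for a
      using that zero_way_below[of t]
      by (subst ennreal_SUP_add_right) (auto intro: SUP_least)
    then show "regularization l s + regularization l t \<le> regularization l (s + t)"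
      unfolding regularization_def[of l s] regularization_def[of l t]
      using zero_way_below[of s]
      by (subst ennreal_SUP_add_left[symmetric]) (auto intro: SUP_least)
  qed
  moreover have "regularization l 0 = 0"
    using regularization_le[OF mono, of 0] zero by simp
  moreover have "regularization l u = (SUP n. regularization l (x n))"
    if x: "incseq x" "seq_sup x u" for x u
  proof (rule antisym)
    obtain w where w: "incseq w" "seq_sup w u" "\<And>n. w n \<lless> w (Suc n)" "\<And>n. w n \<lless> u"
      using way_below_seqE[of u] by blast
    show "regularization l u \<le> (SUP n. regularization l (x n))"
    proof (rule regularization_leI)
      fix z assume "z \<lless> u"
      then obtain n where "z \<le> w n"
        using w(1,2) unfolding way_below_def by blast
      \<comment> \<open>The index \<open>Suc n\<close> leaves a gap:
        \<open>z \<le> w n \<lless> w (Suc n) \<le> x k\<close> yields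
        \<open>z \<lless> x k\<close>, not merely \<open>z \<le> x k\<close>.\<close>
      moreover obtain k where "w (Suc n) \<le> x k"
        using w(4)[of "Suc n"] x unfolding way_below_def by blast
      ultimately have "z \<lless> x k"
        using w(3) by (meson le_way_below_trans way_below_le_trans)
      then show "l z \<le> (SUP n. regularization l (x n))"
        by (intro SUP_upper2[of k] le_regularization) simp_all
    qed
    show "(SUP n. regularization l (x n)) \<le> regularization l u"
      using x(2) by (intro SUP_least monoD[OF regmono]) (simp add: seq_sup_def)
  qed
  ultimately show ?thesis
    using regmono by (auto simp: functionals_def)
qed

section \<open>From functionals to multiples and back\<close>

lemma functionals_le_imp_ratio_le_one:
  fixes s t :: "'a::cuntz_semigroup"
  assumes le: "\<And>l. l \<in> functionals \<Longrightarrow> l s \<le> l t" and "s' \<lless> s"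
  shows "ratio t s' \<le> 1"
proof -
  obtain l where l: "\<And>y z. l (y + z) = l y + l z" "mono l" "l 0 = 0" "l \<le> ratio t" "l s' = ratio t s'"
    using exists_additive_below_sublinear[OF sublinear_ratio] by blast
  \<comment> \<open>The hypothesis applies to functionals, so \<open>l\<close> is replaced by its
    regularization; \<open>s' \<lless> s\<close> ensures that the value at \<open>s\<close> still
    dominates \<open>l s'\<close>.\<close>
  have "ratio t s' \<le> regularization l s"
    using le_regularization[OF assms(2), of l] l(5) by simp
  also have "\<dots> \<le> regularization l t"
    by (intro le regularization_functional l)
  also have "\<dots> \<le> l t"
    by (rule regularization_le[OF l(2)])
  also have "\<dots> \<le> ratio t t"
    using l(4) by (simp add: le_fun_def)
  also have "\<dots> \<le> 1"
    using ratio_le[of 1 t 1 t] by simp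
  finally show ?thesis .
qed

lemma ratio_le_one_imp_multiples:
  fixes x t :: "'a::ordered_semigroup" and \<epsilon> :: real
  assumes "ratio t x \<le> 1" "\<epsilon> > 0"
  shows "\<exists>M N. N > 0 \<and> real M / real N > 1 - \<epsilon> \<and> nat_mult M x \<le> nat_mult N t"
proof -
  \<comment> \<open>The cap \<open>1 / 2\<close> keeps \<open>1 - \<delta>\<close> positive, so that
    it can be inverted.\<close>
  define \<delta> where "\<delta> = min \<epsilon> (1 / 2)"
  have \<delta>: "0 < \<delta>" "\<delta> < 1" "\<delta> \<le> \<epsilon>"
    using assms(2) by (auto simp: \<delta>_def)
  have "1 < ennreal (1 / (1 - \<delta>))"
    using \<delta> by (subst ennreal_1[symmetric], subst ennreal_less_iff) (auto simp: field_simps)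
  then have "ratio t x < ennreal (1 / (1 - \<delta>))"
    using assms(1) by (rule le_less_trans[rotated])
  then obtain M N :: nat where MN: "M > 0" "nat_mult M x \<le> nat_mult N t"
      "ennreal (real N / real M) < ennreal (1 / (1 - \<delta>))"
    unfolding ratio_def by (auto simp: INF_less_iff)
  have lt: "real N * (1 - \<delta>) < real M"
    using MN(1,3) \<delta> by (simp add: ennreal_less_iff field_simps)
  show ?thesis
  proof (cases "N = 0")
    \<comment> \<open>Here the quotient \<open>M / N\<close> is useless, but
      \<open>nat_mult M x \<le> 0 \<le> t\<close> allows denominator \<open>1\<close>.\<close>
    case True
    then have "nat_mult M x \<le> nat_mult 1 t"
      using MN(2) zero_least[of t] by simp
    moreover have "1 - \<epsilon> < real M / real 1"
      using MN(1) assms(2) by simp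
    ultimately show ?thesis by blast
  next
    case False
    then have "1 - \<delta> < real M / real N"
      using lt by (simp add: field_simps)
    then show ?thesis
      using False \<delta> MN(2) by (intro exI[of _ M] exI[of _ N]) simp
  qed
qed

text \<open>For finite \<open>b\<close>, one choice of \<open>\<epsilon>\<close> shows that
  \<open>a\<close> is finite; then \<open>(1 - \<epsilon>) * a \<le> b\<close> holds over the reals
  for every \<open>\<epsilon> > 0\<close>.\<close>

lemma ennreal_le_of_multiples:
  fixes a b :: ennreal
  assumes "\<And>\<epsilon>::real. \<epsilon> > 0 \<Longrightarrow>
    \<exists>M N::nat. N > 0 \<and> real M / real N > 1 - \<epsilon> \<and> of_nat M * a \<le> of_nat N * b"
  shows "a \<le> b"
proof (cases "b = top")
  case False
  then obtain b' where b': "b = ennreal b'" "b' \<ge> 0"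
    by (cases b) auto
  \<comment> \<open>Any \<open>\<epsilon>\<close> below \<open>1\<close> would do: it forces
    \<open>M > 0\<close>, so an infinite \<open>a\<close> would make \<open>of_nat N * b\<close>
    infinite.\<close>
  obtain M N :: nat where MN: "N > 0" "real M / real N > 1 - 1/2" "of_nat M * a \<le> of_nat N * b"
    using assms[of "1/2"] by auto
  have "a \<noteq> top"
  proof
    assume "a = top"
    moreover have "M > 0"
      using MN(2) by (cases M) auto
    ultimately show False
      using MN(3) False by (simp add: ennreal_mult_top top_unique ennreal_mult_eq_top_iff)
  qed
  then obtain a' where a': "a = ennreal a'" "a' \<ge> 0"
    by (cases a) auto
  have "a' \<le> b' + e * a'" if e: "e > 0" for e
  proof -
    obtain M N :: nat where MN: "N > 0" "real M / real N > 1 - e" "of_nat M * a \<le> of_nat N * b"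
      using assms[OF e] by blast
    have "real M * a' \<le> real N * b'"
      using MN(3) a' b' by (simp add: ennreal_of_nat_eq_real_of_nat ennreal_mult'[symmetric])
    then have "real M / real N * a' \<le> b'"
      using MN(1) by (simp add: field_simps)
    moreover have "(1 - e) * a' \<le> real M / real N * a'"
      using MN(2) a'(2) by (intro mult_right_mono) auto
    ultimately show ?thesis
      by (simp add: algebra_simps)
  qed
  \<comment> \<open>Take \<open>e = d / a'\<close>, which requires \<open>a'\<close> to be
    nonzero.\<close>
  then have "a' \<le> b' + d" if "d > 0" for d
  proof (cases "a' = 0")
    case False
    then show ?thesis
      using \<open>\<And>e. e > 0 \<Longrightarrow> a' \<le> b' + e * a'\<close>[of "d / a'"] that a'(2) by simp
  qed (use that b'(2) in auto)
  then have "a' \<le> b'"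
    by (rule field_le_epsilon)
  then show ?thesis
    using a' b' by (simp add: ennreal_leI)
qed simp

theorem proposition2p2p6:
  fixes s t :: "'a::cuntz_semigroup"
  shows "(\<forall>l\<in>functionals. hat s l \<le> hat t l) \<longleftrightarrow>
    (\<forall>\<epsilon>::real. \<epsilon> > 0 \<longrightarrow> (\<forall>s'. s' \<lless> s \<longrightarrow>
      (\<exists>M N::nat. N > 0 \<and> real M / real N > 1 - \<epsilon> \<and> nat_mult M s' \<le> nat_mult N t)))"
    (is "?L \<longleftrightarrow> ?R")
proof
  assume ?L
  then show ?R
    by (intro allI impI ratio_le_one_imp_multiples functionals_le_imp_ratio_le_one[of s t]) (auto simp: hat_def)
next
  assume R: ?R
  show ?L
    unfolding hat_def
  proof
    fix l :: "'a \<Rightarrow> ennreal" assume "l \<in> functionals"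
    then have add: "\<And>a b. l (a + b) = l a + l b" and mono: "mono l" and zero: "l 0 = 0"
      and sup: "\<And>x u. incseq x \<Longrightarrow> seq_sup x u \<Longrightarrow> l u = (SUP n. l (x n))"
      by (auto simp: functionals_def)
    have "l s' \<le> l t" if "s' \<lless> s" for s'
    proof (rule ennreal_le_of_multiples)
      fix \<epsilon> :: real assume "\<epsilon> > 0"
      then obtain M N :: nat where "N > 0" "real M / real N > 1 - \<epsilon>" "nat_mult M s' \<le> nat_mult N t"
        using R \<open>s' \<lless> s\<close> by blast
      then show "\<exists>M N::nat. N > 0 \<and> real M / real N > 1 - \<epsilon> \<and> of_nat M * l s' \<le> of_nat N * l t"
        using monoD[OF mono] additive_nat_mult[of l, OF add zero] by metis
    qed
    \<comment> \<open>The bound on all \<open>s' \<lless> s\<close> reaches \<open>s\<close> because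
      \<open>l\<close> preserves the supremum of a sequence supplied by \<open>O2\<close>.\<close>
    moreover obtain x where "incseq x" "seq_sup x s" "\<And>n. x n \<lless> s"
      using way_below_seqE by metis
    ultimately show "l s \<le> l t"
      by (simp add: sup SUP_le_iff)
  qed
qed

end
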